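(* Let $N\ge1$ be an integer and let $B,R,h>0$. There exist a dimension $n$, a nonempty closed convex set $X\subseteq\mathbb{R}^n$, a convex function $f$ whose domain contains $X$, with nonempty subdifferential at every point of $X$ and with $B$-bounded subgradients on $X$, a minimizer $x^*$ of $f$ over $X$, a point $x^1\in X$ with $\|x^1-x^*\|\le R$, and a choice of subgradients $g^k\in\partial f(x^k)$, $k=1,\dots,N$, such that the iterates $x^{k+1}=P_X\left(x^k-h\tfrac{R}{B}g^k\right)$, $k=1,\dots,N$, satisfy $$f(x^{N+1})-f(x^* )=\begin{cases}BR\,(1-Nh)&\text{if } h\le \frac{1}{s_{N+1}^2},\\[2mm] BR\left(\left(\tfrac12 s_{N+1}^2-N\right)h+\frac{1}{2s_{N+1}^2h}\right)&\text{if } h>\frac{1}{s_{N+1}^2}.\end{cases}$$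
   Context: $\|\cdot\|$ is the Euclidean norm and $P_X$ is the Euclidean projection onto $X$. The subdifferential is $\partial f(x)=\{g\in\mathbb{R}^n : f(y)\ge f(x)+\langle g,y-x\rangle \text{ for all } y\in\mathrm{dom} f\}$. The function $f$ has $B$-bounded subgradients on $X$ if $\|g\|\le B$ for all $x\in X$ and $g\in\partial f(x)$. The real sequence $(s_k)_{k\ge1}$ is defined by $s_1=1$ and $s_{k+1}=s_k+\frac{1}{s_k}$. *)

theory Defs
  imports "HOL-Analysis.Analysis"
begin

text \<open>
  The dimension is existentially quantified, so it cannot be a type index.  Points of the
  n-dimensional space are the elements of \<^term>\<open>topspace (Euclidean_space n)\<close>: functions
  \<^typ>\<open>nat \<Rightarrow> real\<close> that vanish at all indices \<open>i \<ge> n\<close>; equality of points is equality of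
  functions, and \<^term>\<open>closedin (Euclidean_space n)\<close> is closedness in the usual topology.
\<close>

abbreviation Rn :: "nat \<Rightarrow> (nat \<Rightarrow> real) set" where
  "Rn n \<equiv> topspace (Euclidean_space n)"

definition inner_n :: "nat \<Rightarrow> (nat \<Rightarrow> real) \<Rightarrow> (nat \<Rightarrow> real) \<Rightarrow> real" where
  "inner_n n x y = (\<Sum>i<n. x i * y i)"

definition norm_n :: "nat \<Rightarrow> (nat \<Rightarrow> real) \<Rightarrow> real" where
  "norm_n n x = L2_set x {..<n}"

text \<open>
  The library's \<^const>\<open>convex\<close> and \<^const>\<open>convex_on\<close> need a \<^class>\<open>real_vector\<close> type, which
  \<^typ>\<open>nat \<Rightarrow> real\<close> is not, so they are restated with coordinatewise operations.
\<close>

definition convex_n :: "nat \<Rightarrow> (nat \<Rightarrow> real) set \<Rightarrow> bool" where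
  "convex_n n S \<longleftrightarrow> S \<subseteq> Rn n \<and>
     (\<forall>x\<in>S. \<forall>y\<in>S. \<forall>t\<in>{0..1}. (\<lambda>i. (1 - t) * x i + t * y i) \<in> S)"

text \<open>
  An extended-valued convex function \<open>f\<close> is given by its effective domain \<open>D\<close> and its real values
  on \<open>D\<close>; the values of the HOL function outside \<open>D\<close> play no role.
\<close>

definition convex_fun_n :: "nat \<Rightarrow> (nat \<Rightarrow> real) set \<Rightarrow> ((nat \<Rightarrow> real) \<Rightarrow> real) \<Rightarrow> bool" where
  "convex_fun_n n D f \<longleftrightarrow> convex_n n D \<and>
     (\<forall>x\<in>D. \<forall>y\<in>D. \<forall>t\<in>{0..1}.
        f (\<lambda>i. (1 - t) * x i + t * y i) \<le> (1 - t) * f x + t * f y)"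

definition subdiff ::
    "nat \<Rightarrow> (nat \<Rightarrow> real) set \<Rightarrow> ((nat \<Rightarrow> real) \<Rightarrow> real) \<Rightarrow> (nat \<Rightarrow> real) \<Rightarrow> (nat \<Rightarrow> real) set" where
  "subdiff n D f x = {g \<in> Rn n. \<forall>y\<in>D. f y \<ge> f x + inner_n n g (\<lambda>i. y i - x i)}"

definition bounded_subgradients ::
    "nat \<Rightarrow> (nat \<Rightarrow> real) set \<Rightarrow> ((nat \<Rightarrow> real) \<Rightarrow> real) \<Rightarrow> (nat \<Rightarrow> real) set \<Rightarrow> real \<Rightarrow> bool" where
  "bounded_subgradients n D f X B \<longleftrightarrow> (\<forall>x\<in>X. \<forall>g\<in>subdiff n D f x. norm_n n g \<le> B)"

text \<open>Meaningful for nonempty closed convex \<open>X\<close>, where the nearest point exists and is unique.\<close>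

definition proj :: "nat \<Rightarrow> (nat \<Rightarrow> real) set \<Rightarrow> (nat \<Rightarrow> real) \<Rightarrow> (nat \<Rightarrow> real)" where
  "proj n X a = arg_min_on (\<lambda>y. norm_n n (\<lambda>i. a i - y i)) X"

text \<open>The sequence starts at index 1; the value at 0 is a placeholder.\<close>

fun s :: "nat \<Rightarrow> real" where
  "s 0 = 0"
| "s (Suc 0) = 1"
| "s (Suc (Suc k)) = s (Suc k) + 1 / s (Suc k)"

end

theory Submission
  imports Defs
begin

text \<open>
  Take \<open>f = max {0, B \<langle>\<gamma>\<^sub>1, \<cdot>\<rangle>, \<dots>, B \<langle>\<gamma>\<^sub>N\<^sub>+\<^sub>1, \<cdot>\<rangle>}\<close> on the whole space with minimizer \<open>0\<close>, where
  the \<open>\<gamma>\<^sub>k\<close> are unit vectors whose Gram matrix depends only on the smaller index: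
  \<open>\<langle>\<gamma>\<^sub>i, \<gamma>\<^sub>k\<rangle> = c\<^sub>i\<close> for \<open>i < k\<close>.  Start at \<open>x\<^sup>1 = R e\<^sub>0\<close> with \<open>\<langle>e\<^sub>0, \<gamma>\<^sub>k\<rangle> = a\<close> for all \<open>k\<close>.  If \<open>c\<close> is
  decreasing, the piece \<open>\<gamma>\<^sub>k\<close> is active at \<open>x\<^sup>k = R (e\<^sub>0 - h (\<gamma>\<^sub>1 + \<dots> + \<gamma>\<^sub>k\<^sub>-\<^sub>1))\<close>, so the final value
  is \<open>B R (a - h (c\<^sub>1 + \<dots> + c\<^sub>N))\<close>.  Built coordinate by coordinate, such a family in dimension
  \<open>N + 1\<close> has one free parameter per coordinate; minimizing \<open>c\<^sub>1 + \<dots> + c\<^sub>N\<close> greedily from the last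
  coordinate backwards produces the recursion of \<open>s\<close>, and optimizing over \<open>a \<le> 1\<close> produces the
  two regimes of the bound.
\<close>

section \<open>Maxima of finitely many linear functions\<close>

lemma inner_n_sum_left:
  "inner_n n (\<lambda>j. \<Sum>i\<in>I. u i j) y = (\<Sum>i\<in>I. inner_n n (u i) y)"
  unfolding inner_n_def by (simp add: sum_distrib_right) (rule sum.swap)

lemma inner_n_scale_left: "inner_n n (\<lambda>j. c * u j) y = c * inner_n n u y"
  unfolding inner_n_def by (simp add: sum_distrib_left mult.assoc)

lemma inner_n_diff_left: "inner_n n (\<lambda>j. u j - v j) y = inner_n n u y - inner_n n v y"
  unfolding inner_n_def by (simp add: sum_subtractf left_diff_distrib)

lemma inner_n_commute: "inner_n n x y = inner_n n y x"
  unfolding inner_n_def by (simp add: mult.commute)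

lemma inner_n_comb_right:
  "inner_n n x (\<lambda>j. \<alpha> * u j + \<beta> * v j) = \<alpha> * inner_n n x u + \<beta> * inner_n n x v"
  unfolding inner_n_def by (simp add: sum_distrib_left sum.distrib algebra_simps)

lemma norm_n_square: "(norm_n n x)\<^sup>2 = inner_n n x x"
  unfolding norm_n_def inner_n_def L2_set_def
  by (simp add: sum_nonneg power2_eq_square)

lemma norm_n_nonneg: "0 \<le> norm_n n x"
  by (simp add: norm_n_def)

lemma inner_n_le_norm: "inner_n n x y \<le> norm_n n x * norm_n n y"
proof -
  have "inner_n n x y \<le> (\<Sum>i<n. \<bar>x i\<bar> * \<bar>y i\<bar>)"
    unfolding inner_n_def by (intro sum_mono) (simp flip: abs_mult)
  also have "\<dots> \<le> norm_n n x * norm_n n y"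
    unfolding norm_n_def by (rule L2_set_mult_ineq)
  finally show ?thesis .
qed

lemma Rn_iff: "x \<in> Rn n \<longleftrightarrow> (\<forall>i\<ge>n. x i = 0)"
  by (simp add: topspace_Euclidean_space)

lemma convex_n_Rn: "convex_n n (Rn n)"
  by (simp add: convex_n_def Rn_iff)

text \<open>\<open>proj\<close> picks some minimizer by choice, so distance 0 has to single out the
  point itself. This reduces the projected step on the whole space to a plain subgradient
  step.\<close>

lemma proj_Rn:
  assumes "a \<in> Rn n"
  shows "proj n (Rn n) a = a"
proof -
  have zero: "norm_n n (\<lambda>i. a i - a i) = 0"
    by (simp add: norm_n_def L2_set_def)
  have "y = a" if y: "y \<in> Rn n" "norm_n n (\<lambda>i. a i - y i) = 0" for y
  proof
    fix i
    have "\<forall>i<n. a i - y i = 0"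
      using y(2) by (auto simp: norm_n_def L2_set_eq_0_iff)
    then show "y i = a i"
      using assms y(1) by (cases "i < n") (auto simp: Rn_iff)
  qed
  then have "is_arg_min (\<lambda>y. norm_n n (\<lambda>i. a i - y i)) (\<lambda>y. y \<in> Rn n) y \<longleftrightarrow> y = a" for y
    using assms zero norm_n_nonneg unfolding is_arg_min_linorder
    by (metis order_antisym)
  then have "is_arg_min (\<lambda>y. norm_n n (\<lambda>i. a i - y i)) (\<lambda>y. y \<in> Rn n) = (\<lambda>y. y = a)"
    by blast
  then show ?thesis
    unfolding proj_def arg_min_on_def arg_min_def by simp
qed

definition max_linear :: "nat \<Rightarrow> nat \<Rightarrow> (nat \<Rightarrow> nat \<Rightarrow> real) \<Rightarrow> (nat \<Rightarrow> real) \<Rightarrow> real" where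
  "max_linear n M G z = (MAX k\<in>{..M}. inner_n n (G k) z)"

lemma max_linear_ge: "k \<le> M \<Longrightarrow> inner_n n (G k) z \<le> max_linear n M G z"
  unfolding max_linear_def by (intro Max_ge) auto

lemma max_linear_le:
  "(\<And>k. k \<le> M \<Longrightarrow> inner_n n (G k) z \<le> c) \<Longrightarrow> max_linear n M G z \<le> c"
  unfolding max_linear_def by (intro Max.boundedI) auto

lemma max_linear_attained: "\<exists>k\<le>M. max_linear n M G z = inner_n n (G k) z"
proof -
  have "max_linear n M G z \<in> (\<lambda>k. inner_n n (G k) z) ` {..M}"
    unfolding max_linear_def by (intro Max_in) auto
  then show ?thesis by auto
qed

lemma convex_fun_max_linear: "convex_fun_n n (Rn n) (max_linear n M G)"
  unfolding convex_fun_n_def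
proof (intro conjI ballI convex_n_Rn)
  fix x y and t :: real
  assume t: "t \<in> {0..1}"
  show "max_linear n M G (\<lambda>i. (1 - t) * x i + t * y i)
      \<le> (1 - t) * max_linear n M G x + t * max_linear n M G y"
  proof (rule max_linear_le)
    fix k assume "k \<le> M"
    then show "inner_n n (G k) (\<lambda>i. (1 - t) * x i + t * y i)
        \<le> (1 - t) * max_linear n M G x + t * max_linear n M G y"
      unfolding inner_n_comb_right using t
      by (intro add_mono mult_left_mono max_linear_ge) auto
  qed
qed

lemma active_in_subdiff:
  assumes "G k \<in> Rn n" "k \<le> M" "max_linear n M G z = inner_n n (G k) z"
  shows "G k \<in> subdiff n (Rn n) (max_linear n M G) z"
proof -
  have "inner_n n (G k) (\<lambda>i. y i - z i) = inner_n n (G k) y - inner_n n (G k) z" for y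
    using inner_n_diff_left inner_n_commute by metis
  then show ?thesis
    using assms max_linear_ge[OF assms(2)] by (auto simp: subdiff_def)
qed

lemma subdiff_max_linear_nonempty:
  assumes "\<And>k. k \<le> M \<Longrightarrow> G k \<in> Rn n"
  shows "subdiff n (Rn n) (max_linear n M G) z \<noteq> {}"
  using max_linear_attained active_in_subdiff assms by blast

text \<open>Moving from \<open>z\<close> by a subgradient \<open>g\<close> raises the maximum by at
  least the squared norm of \<open>g\<close>, while each linear piece rises by at most
  \<open>B\<close> times that norm.\<close>

lemma bounded_subgradients_max_linear:
  assumes "\<And>k. k \<le> M \<Longrightarrow> norm_n n (G k) \<le> B"
  shows "bounded_subgradients n (Rn n) (max_linear n M G) (Rn n) B"
  unfolding bounded_subgradients_def
proof (intro ballI)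
  fix z g
  assume z: "z \<in> Rn n" and g: "g \<in> subdiff n (Rn n) (max_linear n M G) z"
  \<comment> \<open>Test the subgradient inequality at \<open>z + g\<close>.\<close>
  define y where "y = (\<lambda>i. 1 * z i + 1 * g i)"
  have "y \<in> Rn n"
    using z g by (auto simp: y_def subdiff_def Rn_iff)
  then have "max_linear n M G z + inner_n n g (\<lambda>i. y i - z i) \<le> max_linear n M G y"
    using g by (auto simp: subdiff_def)
  moreover obtain k where k: "k \<le> M" "max_linear n M G y = inner_n n (G k) y"
    using max_linear_attained by blast
  moreover have "inner_n n (G k) y = inner_n n (G k) z + inner_n n (G k) g"
    unfolding y_def inner_n_comb_right by simp
  moreover have "inner_n n (G k) z \<le> max_linear n M G z"
    using k max_linear_ge by blast
  moreover have "inner_n n (G k) g \<le> B * norm_n n g"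
    using inner_n_le_norm[of n "G k" g] mult_right_mono[OF assms[OF k(1)] norm_n_nonneg[of n g]]
    by linarith
  ultimately have "(norm_n n g)\<^sup>2 \<le> B * norm_n n g"
    by (simp add: norm_n_square y_def)
  then show "norm_n n g \<le> B"
    using norm_n_nonneg[of n g] norm_n_nonneg[of n "G k"] assms[OF k(1)]
    by (cases "norm_n n g = 0") (auto simp: power2_eq_square)
qed

section \<open>Unit vectors with a prescribed staircase Gram matrix\<close>

text \<open>
  \<open>sq_rest m j\<close> is the squared length left after coordinates \<open>0, \<dots>, j - 1\<close> have taken the
  fractions \<open>m\<close>.
\<close>

primrec sq_rest :: "(nat \<Rightarrow> real) \<Rightarrow> nat \<Rightarrow> real" where
  "sq_rest m 0 = 1"
| "sq_rest m (Suc j) = sq_rest m j * (1 - (m j)\<^sup>2)"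

text \<open>Row \<open>k\<close> of a Cholesky factor: coordinates before \<open>k\<close> are
  shared with all later rows, and coordinate \<open>k\<close> receives all the remaining
  length.\<close>

definition stair :: "(nat \<Rightarrow> real) \<Rightarrow> nat \<Rightarrow> nat \<Rightarrow> real" where
  "stair m k j = (if j < k then sqrt (sq_rest m j) * m j
     else if j = k then sqrt (sq_rest m k) else 0)"

lemma sq_rest_nonneg: "(\<And>j. \<bar>m j\<bar> \<le> 1) \<Longrightarrow> 0 \<le> sq_rest m k"
  by (induction k) (auto simp: abs_square_le_1)

lemma sqrt_sq_rest_mult:
  assumes "\<And>j. \<bar>m j\<bar> \<le> 1"
  shows "sqrt (sq_rest m j) * sqrt (sq_rest m j) = sq_rest m j"
    and "sqrt (sq_rest m j) * (sqrt (sq_rest m j) * d) = sq_rest m j * d"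
    and "sqrt (sq_rest m j) * c * (sqrt (sq_rest m j) * d) = sq_rest m j * (c * d)"
  using sq_rest_nonneg[of m j, OF assms] by (simp_all add: algebra_simps flip: power2_eq_square)

lemma sum_sq_rest: "(\<Sum>j<k. sq_rest m j * (m j)\<^sup>2) = 1 - sq_rest m k"
  by (induction k) (auto simp: algebra_simps)

text \<open>Below coordinate \<open>i\<close> the two rows agree and contribute the length already
  used, \<open>1 - sq_rest m i\<close>; after coordinate \<open>i\<close> the first row vanishes.
  Hence the value does not depend on \<open>k\<close>.\<close>

lemma inner_stair_less:
  assumes m: "\<And>j. \<bar>m j\<bar> \<le> 1" and "i < k" "i < n"
  shows "inner_n n (stair m i) (stair m k) = 1 - sq_rest m i * (1 - m i)"
proof -
  have "inner_n n (stair m i) (stair m k) = (\<Sum>j<Suc i. stair m i j * stair m k j)"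
    unfolding inner_n_def
    by (rule sum.mono_neutral_right) (use assms in \<open>auto simp: stair_def\<close>)
  also have "\<dots> = (\<Sum>j<i. sq_rest m j * (m j)\<^sup>2) + sq_rest m i * m i"
    using \<open>i < k\<close>
    by (auto simp: stair_def sqrt_sq_rest_mult[of m, OF m] power2_eq_square intro!: sum.cong)
  finally show ?thesis
    by (simp add: sum_sq_rest algebra_simps)
qed

text \<open>The case \<open>k = n\<close> fits one extra unit vector into the space: its diagonal
  entry would lie outside, but no length is left for it.\<close>

lemma inner_stair_self:
  assumes m: "\<And>j. \<bar>m j\<bar> \<le> 1" and "k < n \<or> k = n \<and> sq_rest m n = 0"
  shows "inner_n n (stair m k) (stair m k) = 1"
proof -
  have "inner_n n (stair m k) (stair m k) = (\<Sum>j<Suc k. stair m k j * stair m k j)"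
    using assms(2)
  proof
    assume "k < n"
    then show ?thesis
      unfolding inner_n_def
      by (intro sum.mono_neutral_right) (auto simp: stair_def)
  qed (simp add: inner_n_def stair_def)
  also have "\<dots> = (\<Sum>j<k. sq_rest m j * (m j)\<^sup>2) + sq_rest m k"
    using sq_rest_nonneg[of m k, OF m]
    by (auto simp: stair_def sqrt_sq_rest_mult[of m, OF m] power2_eq_square intro!: sum.cong)
  finally show ?thesis
    by (simp add: sum_sq_rest)
qed

lemma stair_in_Rn:
  assumes "k < n \<or> k = n \<and> sq_rest m n = 0"
  shows "stair m k \<in> Rn n"
  using assms by (auto simp: Rn_iff stair_def)

section \<open>The optimal parameters\<close>

lemma s_ge_1: "k \<ge> 1 \<Longrightarrow> s k \<ge> 1"
proof (induction k rule: s.induct)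
  case (3 k)
  then have "1 \<le> s (Suc k)" by simp
  then have "0 \<le> 1 / s (Suc k)" by simp
  with \<open>1 \<le> s (Suc k)\<close> show ?case unfolding s.simps by linarith
qed auto

lemma s_step: "k \<ge> 1 \<Longrightarrow> s (Suc k) = s k + 1 / s k"
  by (cases k) auto

lemma s_square_step:
  assumes "k \<ge> 1"
  shows "(s (Suc k))\<^sup>2 = (s k)\<^sup>2 + 2 + 1 / (s k)\<^sup>2"
  using s_ge_1[OF assms] unfolding s_step[OF assms]
  by (simp add: power2_eq_square field_simps)

lemma s_square_ge: "(s (Suc k))\<^sup>2 \<ge> 2 * real k + 1"
proof (induction k)
  case (Suc k)
  have "2 * real (Suc k) + 1 = (2 * real k + 1) + 2 + 0" by simp
  also have "\<dots> \<le> (s (Suc k))\<^sup>2 + 2 + 1 / (s (Suc k))\<^sup>2"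
    using Suc by (intro add_mono) auto
  also have "\<dots> = (s (Suc (Suc k)))\<^sup>2"
    by (rule s_square_step[symmetric]) simp
  finally show ?case .
qed simp

text \<open>Coordinate 0 carries the free parameter \<open>a\<close>; the others run through
  \<open>s\<close> backwards, ending at \<open>j = N\<close> with -1, which uses up all the
  length.\<close>

definition opt_frac :: "nat \<Rightarrow> real \<Rightarrow> nat \<Rightarrow> real" where
  "opt_frac N a j = (if j = 0 then a else - 1 / (s (Suc N - j))\<^sup>2)"

text \<open>One minus the inner product of the \<open>i\<close>-th vector with the later ones.\<close>

abbreviation gap :: "nat \<Rightarrow> real \<Rightarrow> nat \<Rightarrow> real" where
  "gap N a i \<equiv> sq_rest (opt_frac N a) i * (1 - opt_frac N a i)"

lemma abs_opt_frac_le_1: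
  assumes "0 \<le> a" "a \<le> 1"
  shows "\<bar>opt_frac N a j\<bar> \<le> 1"
proof (cases "j = 0 \<or> Suc N - j = 0")
  \<comment> \<open>For \<open>j > N\<close> the subtraction truncates to 0, and
    \<open>s 0 = 0\<close> with division by zero makes the fraction 0.\<close>
  case True
  then show ?thesis using assms by (auto simp: opt_frac_def)
next
  case False
  then have "1 \<le> (s (Suc N - j))\<^sup>2"
    using s_ge_1[of "Suc N - j"] by (auto simp: one_le_power)
  then have "1 / (s (Suc N - j))\<^sup>2 \<le> 1"
    by (subst divide_le_eq_1) linarith
  then show ?thesis using False by (simp add: opt_frac_def)
qed

lemma sq_rest_opt_frac_last:
  assumes "N \<ge> 1"
  shows "sq_rest (opt_frac N a) (Suc N) = 0"
  using assms by (simp add: opt_frac_def)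

text \<open>Backward induction. With \<open>r = s (N - k)\<close>, prepending a gap with fraction m
  multiplies the remaining squared length by (1 - m) + (1 - m^2) r^2 / 2. The choice m = -1/r^2
  maximizes this, and the maximum is half the next square of \<open>s\<close>.\<close>

lemma sum_gap:
  assumes N: "N \<ge> 1" and "k \<le> N"
  shows "(\<Sum>i\<in>{Suc k..N}. gap N a i) = sq_rest (opt_frac N a) (Suc k) * (s (Suc N - k))\<^sup>2 / 2"
  using assms(2)
proof (induction k rule: inc_induct)
  case base
  then show ?case using sq_rest_opt_frac_last[OF N] by simp
next
  case (step k)
  define r where "r = s (N - k)"
  have r: "r \<ge> 1" using step s_ge_1 by (simp add: r_def)
  have frac: "opt_frac N a (Suc k) = - 1 / r\<^sup>2"
    by (simp add: opt_frac_def r_def)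
  have next_s: "(s (Suc N - k))\<^sup>2 = r\<^sup>2 + 2 + 1 / r\<^sup>2"
    using s_square_step[of "N - k"] step by (simp add: r_def Suc_diff_le)
  have "{Suc k..N} = insert (Suc k) {Suc (Suc k)..N}"
    using step by auto
  then have "(\<Sum>i\<in>{Suc k..N}. gap N a i)
      = gap N a (Suc k) + sq_rest (opt_frac N a) (Suc (Suc k)) * r\<^sup>2 / 2"
    using step by (simp add: r_def)
  also have "\<dots> = sq_rest (opt_frac N a) (Suc k)
      * ((1 + 1 / r\<^sup>2) + (1 - (1 / r\<^sup>2)\<^sup>2) * r\<^sup>2 / 2)"
    unfolding sq_rest.simps(2)[of _ "Suc k"] frac by (simp add: algebra_simps)
  also have "(1 + 1 / r\<^sup>2) + (1 - (1 / r\<^sup>2)\<^sup>2) * r\<^sup>2 / 2 = (r\<^sup>2 + 2 + 1 / r\<^sup>2) / 2"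
    using r by (simp add: field_simps power2_eq_square)
  finally show ?case by (simp add: next_s)
qed

text \<open>For consecutive values r, p of \<open>s\<close>, the claim reduces to (1 - 1/p^2)(1 +
  1/r^2) \<ge> 1, that is, p^2 \<ge> r^2 + 1.\<close>

lemma gap_step:
  assumes a: "0 \<le> a" "a \<le> 1" and i: "1 \<le> i" "i < N"
  shows "gap N a i \<le> gap N a (Suc i)"
proof -
  define r where "r = s (N - i)"
  have r: "r \<ge> 1" using i s_ge_1 by (simp add: r_def)
  define p where "p = s (Suc N - i)"
  have p: "p\<^sup>2 = r\<^sup>2 + 2 + 1 / r\<^sup>2"
    using s_square_step[of "N - i"] i by (simp add: p_def r_def Suc_diff_le)
  have p': "p\<^sup>2 \<ge> r\<^sup>2 + 2" unfolding p by simp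
  have frac: "opt_frac N a i = - 1 / p\<^sup>2" "opt_frac N a (Suc i) = - 1 / r\<^sup>2"
    using i by (simp_all add: opt_frac_def p_def r_def)
  have "r\<^sup>2 + 1 \<le> p\<^sup>2" using p' by simp
  then have *: "1 \<le> (1 - 1 / p\<^sup>2) * (1 + 1 / r\<^sup>2)"
  proof -
    have "p\<^sup>2 > 0" "r\<^sup>2 > 0" using r p' by (auto simp: power2_eq_square)
       (smt (verit) mult_pos_pos)
    then show ?thesis using \<open>r\<^sup>2 + 1 \<le> p\<^sup>2\<close> by (simp add: field_simps)
  qed
  have "gap N a i = sq_rest (opt_frac N a) i * (1 + 1 / p\<^sup>2) * 1"
    by (simp add: frac)
  also have "\<dots> \<le> sq_rest (opt_frac N a) i * (1 + 1 / p\<^sup>2) * ((1 - 1 / p\<^sup>2) * (1 + 1 / r\<^sup>2))"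
    by (intro mult_left_mono * mult_nonneg_nonneg sq_rest_nonneg abs_opt_frac_le_1 a) simp
  also have "\<dots> = gap N a (Suc i)"
  proof -
    have "q * (1 + u) * ((1 - u) * (1 + v)) = q * (1 - u\<^sup>2) * (1 + v)" for q u v :: real
      by (simp add: algebra_simps power2_eq_square)
    then show ?thesis by (simp add: frac)
  qed
  finally show ?thesis .
qed

lemma gap_mono:
  assumes a: "0 \<le> a" "a \<le> 1" and "1 \<le> i" "i \<le> j" "j \<le> N"
  shows "gap N a i \<le> gap N a j"
  using \<open>i \<le> j\<close> \<open>j \<le> N\<close>
proof (induction j rule: dec_induct)
  case (step j)
  then show ?case using gap_step[OF a, of j N] assms(3) by simp
qed simp

text \<open>Gaps increase from the first one, (1 - a^2)(1 + 1/s_N^2). The resulting bound a^2 on the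
  inner products keeps the active pieces nonnegative.\<close>

lemma gap_ge:
  assumes a: "0 \<le> a" "a \<le> 1" and i: "1 \<le> i" "i \<le> N"
  shows "1 - a\<^sup>2 \<le> gap N a i"
proof -
  have "1 - a\<^sup>2 \<le> (1 - a\<^sup>2) * (1 + 1 / (s N)\<^sup>2)"
    using a by (simp add: algebra_simps power_le_one mult_left_le divide_right_mono)
  also have "\<dots> = gap N a 1"
    by (simp add: opt_frac_def)
  also have "\<dots> \<le> gap N a i"
    using gap_mono[OF a, of 1 i N] i by simp
  finally show ?thesis .
qed

section \<open>The worst-case instance\<close>

theorem mainTheorem3:
  fixes N :: nat and B R h :: real
  assumes "N \<ge> 1" and "B > 0" and "R > 0" and "h > 0"
  shows "\<exists>(n::nat) (X :: (nat \<Rightarrow> real) set) (D :: (nat \<Rightarrow> real) set) (f :: (nat \<Rightarrow> real) \<Rightarrow> real)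
            (xstar :: nat \<Rightarrow> real) (x :: nat \<Rightarrow> nat \<Rightarrow> real) (g :: nat \<Rightarrow> nat \<Rightarrow> real).
     n \<ge> 1 \<and>
     X \<noteq> {} \<and> closedin (Euclidean_space n) X \<and> convex_n n X \<and>
     convex_fun_n n D f \<and> X \<subseteq> D \<and>
     (\<forall>z\<in>X. subdiff n D f z \<noteq> {}) \<and> bounded_subgradients n D f X B \<and>
     xstar \<in> X \<and> (\<forall>z\<in>X. f xstar \<le> f z) \<and>
     x 1 \<in> X \<and> norm_n n (\<lambda>i. x 1 i - xstar i) \<le> R \<and>
     (\<forall>k\<in>{1..N}. g k \<in> subdiff n D f (x k)) \<and>
     (\<forall>k\<in>{1..N}. x (k + 1) = proj n X (\<lambda>i. x k i - h * (R / B) * g k i)) \<and>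
     f (x (N + 1)) - f xstar =
       (if h \<le> 1 / (s (N + 1))\<^sup>2
        then B * R * (1 - real N * h)
        else B * R * ((1 / 2 * (s (N + 1))\<^sup>2 - real N) * h + 1 / (2 * (s (N + 1))\<^sup>2 * h)))"
proof -
  define S where "S = (s (N + 1))\<^sup>2"
  \<comment> \<open>The maximizer over a \<le> 1 of the concave final value a - h (N - (1 - a^2) S /
    2).\<close>
  define a where "a = min 1 (1 / (S * h))"
  define n where "n = Suc N"
  define \<gamma> where "\<gamma> = stair (opt_frac N a)"
  \<comment> \<open>Piece 0 is the zero function, which makes the origin a minimizer;
    \<open>\<gamma> 0\<close> serves only as the starting direction.\<close>
  define G where "G k = (\<lambda>j. if k = 0 then 0 else B * \<gamma> k j)" for k
  define f where "f = max_linear n n G"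
  define x where "x k = (\<lambda>j. R * (\<gamma> 0 j - h * (\<Sum>i\<in>{1..<k}. \<gamma> i j)))" for k
  have S: "S \<ge> 2 * real N + 1"
    using s_square_ge[of N] by (simp add: S_def)
  then have S_pos: "S > 0" by linarith
  have a: "0 \<le> a" "a \<le> 1" and haS: "h * a * S \<le> 1"
    using S_pos \<open>h > 0\<close> by (auto simp: a_def min_def field_simps)
  note frac = abs_opt_frac_le_1[OF a, of N]
  have last: "sq_rest (opt_frac N a) n = 0"
    unfolding n_def by (rule sq_rest_opt_frac_last[OF \<open>N \<ge> 1\<close>])
  have \<gamma>_Rn: "\<gamma> k \<in> Rn n" if "k \<le> n" for k
    unfolding \<gamma>_def using that last by (intro stair_in_Rn) auto
  have \<gamma>_self: "inner_n n (\<gamma> k) (\<gamma> k) = 1" if "k \<le> n" for k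
    unfolding \<gamma>_def using that last by (intro inner_stair_self frac) auto
  have \<gamma>_less: "inner_n n (\<gamma> i) (\<gamma> k) = 1 - gap N a i" if "i < k" "k \<le> n" for i k
    unfolding \<gamma>_def using that by (intro inner_stair_less frac) auto
  have \<gamma>_0: "inner_n n (\<gamma> 0) (\<gamma> k) = a" if "1 \<le> k" "k \<le> n" for k
    using \<gamma>_less[of 0 k] that by (simp add: opt_frac_def)

  have inner_x: "inner_n n (\<gamma> k) (x l) = R * (a - h * (\<Sum>i\<in>{1..<l}. inner_n n (\<gamma> i) (\<gamma> k)))"
    if "1 \<le> k" "k \<le> n" for k l
    unfolding x_def inner_n_commute[of n "\<gamma> k"] inner_n_scale_left inner_n_diff_left
      inner_n_sum_left using \<gamma>_0 that by simp
  have inner_x_self: "inner_n n (\<gamma> k) (x k) = R * (a - h * (\<Sum>i\<in>{1..<k}. 1 - gap N a i))"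
    if "1 \<le> k" "k \<le> n" for k
    using that by (simp add: inner_x \<gamma>_less)

  \<comment> \<open>For each \<open>i < k\<close>, the product of \<open>\<gamma> i\<close> with
    \<open>\<gamma> j\<close> is least when \<open>j > i\<close>: it is 1 for \<open>j = i\<close>,
    and larger for \<open>j < i\<close> because gaps increase. So \<open>\<gamma> k\<close> attains
    the largest product with \<open>x k\<close>.\<close>
  have compare: "inner_n n (\<gamma> j) (x k) \<le> inner_n n (\<gamma> k) (x k)"
    if "1 \<le> k" "k \<le> n" "1 \<le> j" "j \<le> n" for j k
  proof -
    have "1 - gap N a i \<le> inner_n n (\<gamma> i) (\<gamma> j)" if i: "i \<in> {1..<k}" for i
    proof -
      have "i \<le> N" using i \<open>k \<le> n\<close> by (simp add: n_def)
      consider "i < j" | "i = j" | "j < i" by linarith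
      then show ?thesis
      proof cases
        case 1
        then show ?thesis using \<gamma>_less \<open>j \<le> n\<close> by simp
      next
        case 2
        have "0 \<le> gap N a i"
          using frac by (intro mult_nonneg_nonneg sq_rest_nonneg) (auto simp: abs_le_iff)
        then show ?thesis using 2 \<gamma>_self \<open>j \<le> n\<close> by simp
      next
        case 3
        then show ?thesis
          using \<gamma>_less[of j i] inner_n_commute[of n "\<gamma> i" "\<gamma> j"] gap_mono[OF a, of j i N]
            \<open>i \<le> N\<close> \<open>1 \<le> j\<close> by (simp add: n_def)
      qed
    qed
    then have "(\<Sum>i\<in>{1..<k}. 1 - gap N a i) \<le> (\<Sum>i\<in>{1..<k}. inner_n n (\<gamma> i) (\<gamma> j))"
      by (rule sum_mono)
    then show ?thesis
      unfolding inner_x[OF that(3,4)] inner_x_self[OF that(1,2)]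
      using \<open>R > 0\<close> \<open>h > 0\<close> by simp
  qed

  \<comment> \<open>The zero piece must not exceed piece \<open>k\<close>: the subtracted sum is at
    most S a^2, and \<open>h * a * S \<le> 1\<close> bounds its multiple by
    \<open>a\<close>.\<close>
  have nonneg: "0 \<le> inner_n n (\<gamma> k) (x k)" if k: "1 \<le> k" "k \<le> n" for k
  proof -
    have "(\<Sum>i\<in>{1..<k}. 1 - gap N a i) \<le> (\<Sum>i\<in>{1..<k}. a\<^sup>2)"
    proof (rule sum_mono)
      fix i assume "i \<in> {1..<k}"
      then show "1 - gap N a i \<le> a\<^sup>2"
        using gap_ge[OF a, of i N] k by (simp add: n_def)
    qed
    also have "\<dots> \<le> S * a\<^sup>2"
    proof -
      have "real (k - 1) \<le> S" using S k by (simp add: n_def)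
      then show ?thesis by (simp add: mult_right_mono)
    qed
    finally have "h * (\<Sum>i\<in>{1..<k}. 1 - gap N a i) \<le> h * (S * a\<^sup>2)"
      using \<open>h > 0\<close> by (intro mult_left_mono) auto
    also have "\<dots> = (h * a * S) * a" by (simp add: power2_eq_square)
    also have "\<dots> \<le> 1 * a" using haS a by (intro mult_right_mono)
    finally show ?thesis
      using k \<open>R > 0\<close> by (simp add: inner_x_self)
  qed

  have inner_G: "inner_n n (G k) z = (if k = 0 then 0 else B * inner_n n (\<gamma> k) z)" for k z
    unfolding G_def by (auto simp: inner_n_scale_left) (simp add: inner_n_def)
  have G_Rn: "G k \<in> Rn n" if "k \<le> n" for k
    using \<gamma>_Rn[OF that] by (simp add: G_def Rn_iff)
  have G_norm: "norm_n n (G k) \<le> B" if "k \<le> n" for k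
  proof (rule power2_le_imp_le)
    show "(norm_n n (G k))\<^sup>2 \<le> B\<^sup>2"
      unfolding norm_n_square inner_G
      using \<gamma>_self[OF that] inner_n_commute[of n "\<gamma> k" "G k"] inner_G[of k "\<gamma> k"]
      by (auto simp: power2_eq_square)
  qed (use \<open>B > 0\<close> in simp)
  have active: "f (x k) = inner_n n (G k) (x k)" if k: "1 \<le> k" "k \<le> n" for k
  proof (rule order_antisym)
    show "f (x k) \<le> inner_n n (G k) (x k)"
      unfolding f_def
    proof (rule max_linear_le)
      fix j assume "j \<le> n"
      then show "inner_n n (G j) (x k) \<le> inner_n n (G k) (x k)"
        using compare[of k j] nonneg[of k] k \<open>B > 0\<close> by (cases "j = 0") (auto simp: inner_G)
    qed
    show "inner_n n (G k) (x k) \<le> f (x k)"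
      unfolding f_def using k by (intro max_linear_ge)
  qed

  have x_Rn: "x k \<in> Rn n" if "k \<le> Suc n" for k
    using \<gamma>_Rn that by (auto simp: x_def Rn_iff)
  have x_step: "(\<lambda>i. x k i - h * (R / B) * G k i) = x (Suc k)" if "1 \<le> k" for k
    using that \<open>B > 0\<close> by (auto simp: x_def G_def fun_eq_iff algebra_simps)
  have f_0: "f (\<lambda>_. 0) = 0"
    using max_linear_attained[of n n G "\<lambda>_. 0"] by (auto simp: f_def inner_n_def)
  have f_nonneg: "0 \<le> f z" for z
    using max_linear_ge[of 0 n n G z] by (simp add: f_def inner_G)
  have start: "norm_n n (\<lambda>i. x 1 i - 0) \<le> R"
  proof (rule power2_le_imp_le)
    have "x 1 = (\<lambda>j. R * \<gamma> 0 j)" by (simp add: x_def)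
    then have "inner_n n (x 1) (x 1) = R * (R * inner_n n (\<gamma> 0) (\<gamma> 0))"
      by (metis inner_n_commute inner_n_scale_left)
    then show "(norm_n n (\<lambda>i. x 1 i - 0))\<^sup>2 \<le> R\<^sup>2"
      using \<gamma>_self[of 0] by (simp add: norm_n_square) (simp add: power2_eq_square)
  qed (use \<open>R > 0\<close> in simp)
  \<comment> \<open>Piece \<open>n = N + 1\<close> never drives a step; it is there to be active at
    the last iterate.\<close>
  have "f (x (N + 1)) = B * R * (a - h * (\<Sum>i\<in>{1..N}. 1 - gap N a i))"
    using active[of n] inner_x_self[of n] inner_G[of n "x n"] \<open>N \<ge> 1\<close>
    by (simp add: n_def atLeastLessThanSuc_atLeastAtMost)
  also have "(\<Sum>i\<in>{1..N}. 1 - gap N a i) = real N - (1 - a\<^sup>2) * S / 2"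
    using sum_gap[OF \<open>N \<ge> 1\<close>, of 0 a] by (simp add: sum_subtractf S_def opt_frac_def)
  finally have final_value: "f (x (N + 1)) = B * R * (a - h * (real N - (1 - a\<^sup>2) * S / 2))" .
  also have "\<dots> = (if h \<le> 1 / S then B * R * (1 - real N * h)
      else B * R * ((1 / 2 * S - real N) * h + 1 / (2 * S * h)))"
  proof (cases "h \<le> 1 / S")
    case True
    then have "a = 1"
      using S_pos \<open>h > 0\<close> by (simp add: a_def min_def field_simps)
    then show ?thesis using True by simp
  next
    case False
    then have a_eq: "a = 1 / (S * h)"
      using S_pos \<open>h > 0\<close> by (auto simp: a_def min_def field_simps)
    have "a - h * (real N - (1 - a\<^sup>2) * S / 2) = (1 / 2 * S - real N) * h + 1 / (2 * S * h)"
      unfolding a_eq using S_pos \<open>h > 0\<close> by (simp add: field_simps power2_eq_square)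
    then show ?thesis using False by simp
  qed
  finally have "f (x (N + 1)) - f (\<lambda>_. 0) = (if h \<le> 1 / (s (N + 1))\<^sup>2
        then B * R * (1 - real N * h)
        else B * R * ((1 / 2 * (s (N + 1))\<^sup>2 - real N) * h + 1 / (2 * (s (N + 1))\<^sup>2 * h)))"
    unfolding f_0 S_def by simp
  moreover have "\<forall>k\<in>{1..N}. G k \<in> subdiff n (Rn n) f (x k)"
    unfolding f_def
  proof
    fix k assume "k \<in> {1..N}"
    then show "G k \<in> subdiff n (Rn n) (max_linear n n G) (x k)"
      using active[of k] G_Rn[of k] by (intro active_in_subdiff) (auto simp: n_def f_def)
  qed
  moreover have "\<forall>k\<in>{1..N}. x (k + 1) = proj n (Rn n) (\<lambda>i. x k i - h * (R / B) * G k i)"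
    using x_step x_Rn proj_Rn by (simp add: n_def)
  moreover have "bounded_subgradients n (Rn n) f (Rn n) B"
    unfolding f_def using G_norm by (rule bounded_subgradients_max_linear)
  moreover have "\<forall>z\<in>Rn n. subdiff n (Rn n) f z \<noteq> {}"
    unfolding f_def using subdiff_max_linear_nonempty G_Rn by blast
  moreover have "convex_fun_n n (Rn n) f"
    unfolding f_def by (rule convex_fun_max_linear)
  moreover have "(\<lambda>_. 0) \<in> Rn n" by (simp add: Rn_iff)
  moreover have "\<forall>z\<in>Rn n. f (\<lambda>_. 0) \<le> f z" using f_0 f_nonneg by simp
  moreover have "x 1 \<in> Rn n" by (rule x_Rn) simp
  moreover have "n \<ge> 1" by (simp add: n_def)
  ultimately show ?thesis
    using start convex_n_Rn
    by (intro exI[of _ n] exI[of _ "Rn n"] exI[of _ f] exI[of _ "\<lambda>_. 0"] exI[of _ x] exI[of _ G])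
      auto
qed

end
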